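(* Let $P$ be any convex polygon in the plane, let $k\ge 1$, and let $\lambda_1,\dots,\lambda_k>0$ satisfy $\prod_{i=1}^k\lambda_i=1$. Then the refractive outer billiard map $T$ about $P$ with refractive indices $\lambda_1,\dots,\lambda_k$ has a periodic orbit; that is, there exists a strongly regular point $o$ whose orbit $(T^m(o))_{m\in\mathbb{Z}}$ is periodic.
   Context: Refractive outer billiards. $P$ is a (nondegenerate) convex polygon; the indices of $\lambda_i$ are read modulo $k$ (so $\lambda_0=\lambda_k$). For a point $B$ and $\lambda>0$ let $\rho_{B,\lambda}(z)=B+\lambda(B-z)$ (reflection about $B$ followed by scaling by $\lambda$ about $B$). For a point $z$ outside $P$ and not on any line through a side of $P$, there are two supporting rays from $z$ to $P$: $L_+(z)$, with $P$ lying to its right, and $L_-(z)$, with $P$ lying to its left; each touches $P$ at a single vertex. The contact vertex of $L_+(z)$ is the head of $P$ about $z$, that of $L_-(z)$ is the tail of $P$ about $z$. Starting from a point $o=T^0(o)$ outside $P$: for $m\ge 1$, $T^m(o)=\rho_{A_m,\lambda_m}(T^{m-1}(o))$, where $A_m$ is the head of $P$ about $T^{m-1}(o)$; for $m\le 0$, $T^{m-1}(o)=\rho_{A_m,1/\lambda_m}(T^m(o))$, where $A_m$ is the tail of $P$ about $T^m(o)$. A step is undefined when the current point lies on a line through a side of $P$. The point $o$ is strongly regular if $T^m(o)$ is defined for all $m\in\mathbb{Z}$ and none of these points lies on a line through a side of $P$. Orbits are considered for strongly regular points only. Periodicity. The orbit of $o$ is periodic if there exists an integer $N>0$ such that $T^{m+N}(o)=T^m(o)$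 and $\lambda_{m+N}=\lambda_m$ for all $m\in\mathbb{Z}$. *)

theory Defs
  imports "HOL-Analysis.Analysis"
begin

(* The Euclidean plane is modelled by the complex numbers. *)

definition convex_polygon :: "complex set \<Rightarrow> bool" where
  "convex_polygon P \<longleftrightarrow> polytope P \<and> interior P \<noteq> {}"

definition refract :: "complex \<Rightarrow> real \<Rightarrow> complex \<Rightarrow> complex" where
  "refract B l z = B + l *\<^sub>R (B - z)"

definition ray :: "complex \<Rightarrow> complex \<Rightarrow> complex set" where
  "ray z d = {z + t *\<^sub>R d | t. t \<ge> 0}"

(* cnj d * (w - z) has imaginary part det (d, w - z), which is positive iff w lies
   strictly to the left of the line through z directed by d. *)
definition right_of :: "complex set \<Rightarrow> complex \<Rightarrow> complex \<Rightarrow> bool" where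
  "right_of P z d \<longleftrightarrow> (\<forall>w\<in>P. Im (cnj d * (w - z)) \<le> 0)"

definition left_of :: "complex set \<Rightarrow> complex \<Rightarrow> complex \<Rightarrow> bool" where
  "left_of P z d \<longleftrightarrow> (\<forall>w\<in>P. Im (cnj d * (w - z)) \<ge> 0)"

definition is_head :: "complex set \<Rightarrow> complex \<Rightarrow> complex \<Rightarrow> bool" where
  "is_head P z v \<longleftrightarrow> v extreme_point_of P \<and>
     (\<exists>d. d \<noteq> 0 \<and> right_of P z d \<and> ray z d \<inter> P = {v})"

definition is_tail :: "complex set \<Rightarrow> complex \<Rightarrow> complex \<Rightarrow> bool" where
  "is_tail P z v \<longleftrightarrow> v extreme_point_of P \<and>
     (\<exists>d. d \<noteq> 0 \<and> left_of P z d \<and> ray z d \<inter> P = {v})"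

(* Meaningful only for regular points z; see head_ex1 and tail_ex1 below. *)
definition head :: "complex set \<Rightarrow> complex \<Rightarrow> complex" where
  "head P z = (THE v. is_head P z v)"

definition tail :: "complex set \<Rightarrow> complex \<Rightarrow> complex" where
  "tail P z = (THE v. is_tail P z v)"

definition regular_point :: "complex set \<Rightarrow> complex \<Rightarrow> bool" where
  "regular_point P z \<longleftrightarrow> z \<notin> P \<and> (\<forall>e. e edge_of P \<longrightarrow> z \<notin> affine hull e)"

lemma Im_cnj: "Im (cnj d * u) = (\<i> * d) \<bullet> u"
  by (simp add: inner_complex_def)

lemma contact_ex1:
  assumes P: "convex_polygon P" and z: "regular_point P z" and s: "s = 1 \<or> s = (-1::real)"
  shows "\<exists>!v. v extreme_point_of P \<and>
     (\<exists>d. d \<noteq> 0 \<and> (\<forall>w\<in>P. s * Im (cnj d * (w - z)) \<le> 0) \<and> ray z d \<inter> P = {v})"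
proof (rule ex_ex1I)
  have cP: "compact P" "convex P" "P \<noteq> {}"
    using P by (auto simp: convex_polygon_def polytope_imp_compact polytope_imp_convex)
  have zP: "z \<notin> P" using z by (simp add: regular_point_def)
  obtain a b where ab: "a \<bullet> z < b" "\<And>w. w \<in> P \<Longrightarrow> a \<bullet> w > b"
    using separating_hyperplane_closed_point[OF cP(2) compact_imp_closed[OF cP(1)] zP] by blast
  have pos: "a \<bullet> (w - z) > 0" if "w \<in> P" for w
    using ab(1) ab(2)[OF that] by (simp add: inner_diff_right)
  have a0: "a \<noteq> 0" using pos cP(3) by auto
  define f where "f w = s * Im (cnj a * (w - z)) / (a \<bullet> (w - z))" for w
  have cf: "continuous_on P f"
    unfolding f_def using pos by (intro continuous_intros) (auto simp: less_le)
  obtain v where v: "v \<in> P" "\<And>w. w \<in> P \<Longrightarrow> f w \<le> f v"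
    using continuous_attains_sup[OF cP(1,3) cf] by blast
  define d where "d = v - z"
  have d0: "d \<noteq> 0" using v zP by (auto simp: d_def)
  have le: "s * Im (cnj d * (w - z)) \<le> 0" if w: "w \<in> P" for w
  proof -
    define u where "u = w - z"
    have pu: "a \<bullet> u > 0" "a \<bullet> d > 0" using pos w v by (auto simp: u_def d_def)
    have "s * Im (cnj a * u) / (a \<bullet> u) \<le> s * Im (cnj a * d) / (a \<bullet> d)"
      using v(2)[OF w] by (simp add: f_def u_def d_def)
    hence 1: "(s * Im (cnj a * u)) * (a \<bullet> d) \<le> (s * Im (cnj a * d)) * (a \<bullet> u)"
      using pu by (simp add: divide_simps mult.commute)
    have "s * Im (cnj d * u) * (a \<bullet> a)
        = (s * Im (cnj a * u)) * (a \<bullet> d) - (s * Im (cnj a * d)) * (a \<bullet> u)"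
      by (simp add: inner_complex_def algebra_simps)
    hence "s * Im (cnj d * u) * (a \<bullet> a) \<le> 0" using 1 by linarith
    moreover have "a \<bullet> a > 0" using a0 by simp
    ultimately show ?thesis unfolding u_def by (simp add: mult_le_0_iff)
  qed
  define n where "n = \<i> * d"
  have n0: "n \<noteq> 0" using d0 by (simp add: n_def)
  define H where "H = {w. n \<bullet> w = n \<bullet> z}"
  have le': "s * (n \<bullet> w) \<le> s * (n \<bullet> z)" if "w \<in> P" for w
    using le[OF that] unfolding Im_cnj n_def[symmetric] by (simp add: inner_diff_right algebra_simps)
  have face: "(P \<inter> H) face_of P"
    using s
  proof
    assume "s = 1" thus ?thesis unfolding H_def
      using le' by (intro face_of_Int_supporting_hyperplane_le cP) auto
  next
    assume "s = -1" thus ?thesis unfolding H_def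
      using le' by (intro face_of_Int_supporting_hyperplane_ge cP) auto
  qed
  have rH: "ray z d \<subseteq> H"
    by (auto simp: ray_def H_def n_def inner_complex_def algebra_simps)
  have vr: "v \<in> ray z d" unfolding ray_def d_def by (auto intro!: exI[of _ 1])
  have dimH: "aff_dim H = 1" using n0 by (simp add: H_def)
  have "aff_dim (P \<inter> H) \<le> 1" using aff_dim_subset[of "P \<inter> H" H] dimH by simp
  moreover have "aff_dim (P \<inter> H) \<noteq> 1"
  proof
    assume 1: "aff_dim (P \<inter> H) = 1"
    have "affine H" by (simp add: H_def affine_hyperplane)
    hence "affine hull (P \<inter> H) = H"
      using 1 dimH v(1) vr rH
      by (intro affine_dim_equal) (auto simp: hull_minimal)
    moreover have "z \<in> H" by (simp add: H_def)
    ultimately show False using z face 1 by (auto simp: regular_point_def edge_of_def)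
  qed
  moreover have "aff_dim (P \<inter> H) \<noteq> -1" using v(1) vr rH by (auto simp flip: aff_dim_empty)
  ultimately have "aff_dim (P \<inter> H) = 0" using aff_dim_geq[of "P \<inter> H"] by linarith
  then obtain y where "P \<inter> H = {y}" by (auto simp: aff_dim_eq_0)
  moreover have "v \<in> P \<inter> H" using v(1) vr rH by blast
  ultimately have F: "P \<inter> H = {v}" by auto
  have "v extreme_point_of P" using face F by (simp add: face_of_singleton)
  moreover have "ray z d \<inter> P = {v}" using F rH vr v(1) by blast
  ultimately show "\<exists>v. v extreme_point_of P \<and>
     (\<exists>d. d \<noteq> 0 \<and> (\<forall>w\<in>P. s * Im (cnj d * (w - z)) \<le> 0) \<and> ray z d \<inter> P = {v})"
    using d0 le by blast
next
  fix v1 v2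
  assume "v1 extreme_point_of P \<and>
     (\<exists>d. d \<noteq> 0 \<and> (\<forall>w\<in>P. s * Im (cnj d * (w - z)) \<le> 0) \<and> ray z d \<inter> P = {v1})"
  then obtain d1 where 1: "d1 \<noteq> 0" "\<And>w. w \<in> P \<Longrightarrow> s * Im (cnj d1 * (w - z)) \<le> 0"
    "ray z d1 \<inter> P = {v1}" by blast
  assume "v2 extreme_point_of P \<and>
     (\<exists>d. d \<noteq> 0 \<and> (\<forall>w\<in>P. s * Im (cnj d * (w - z)) \<le> 0) \<and> ray z d \<inter> P = {v2})"
  then obtain d2 where 2: "d2 \<noteq> 0" "\<And>w. w \<in> P \<Longrightarrow> s * Im (cnj d2 * (w - z)) \<le> 0"
    "ray z d2 \<inter> P = {v2}" by blast
  have zP: "z \<notin> P" using z by (simp add: regular_point_def)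
  have cP: "convex P" using P by (simp add: convex_polygon_def polytope_imp_convex)
  have vP: "v1 \<in> P" "v2 \<in> P" "v1 \<in> ray z d1" "v2 \<in> ray z d2" using 1 2 by auto
  obtain t1 where t1: "v1 = z + t1 *\<^sub>R d1" "t1 \<ge> 0" using vP(3) by (auto simp: ray_def)
  obtain t2 where t2: "v2 = z + t2 *\<^sub>R d2" "t2 \<ge> 0" using vP(4) by (auto simp: ray_def)
  have tp: "t1 > 0" "t2 > 0" using t1 t2 zP vP by (auto simp: less_le)
  have e1: "s * Im (cnj d1 * d2) * t2 \<le> 0" using 1(2)[OF vP(2)] t2 by (simp add: algebra_simps)
  have e2: "s * Im (cnj d2 * d1) * t1 \<le> 0" using 2(2)[OF vP(1)] t1 by (simp add: algebra_simps)
  have e1: "s * Im (cnj d1 * d2) \<le> 0" using e1 tp by (simp add: mult_le_0_iff)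
  have e2: "s * Im (cnj d2 * d1) \<le> 0" using e2 tp by (simp add: mult_le_0_iff)
  have z0: "Im (cnj d1 * d2) = 0" using e1 e2 s by (auto simp: algebra_simps)
  define c where "c = Re (cnj d1 * d2) / (d1 \<bullet> d1)"
  have "(d1 \<bullet> d1) *\<^sub>R d2 = Re (cnj d1 * d2) *\<^sub>R d1"
  proof -
    have "complex_of_real (d1 \<bullet> d1) * d2 = d1 * (cnj d1 * d2)"
      by (simp add: complex_eq_iff inner_complex_def algebra_simps)
    also have "cnj d1 * d2 = of_real (Re (cnj d1 * d2))" using z0 by (simp add: complex_eq_iff)
    finally show ?thesis by (simp add: scaleR_conv_of_real mult.commute)
  qed
  hence "(1 / (d1 \<bullet> d1)) *\<^sub>R ((d1 \<bullet> d1) *\<^sub>R d2) = (1 / (d1 \<bullet> d1)) *\<^sub>R (Re (cnj d1 * d2) *\<^sub>R d1)" by simp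
  hence d2: "d2 = c *\<^sub>R d1" using 1(1) by (simp add: c_def)
  show "v1 = v2"
  proof (cases "c > 0")
    case True
    hence "v2 \<in> ray z d1" unfolding ray_def t2 d2 using tp by (auto intro!: exI[of _ "t2 * c"])
    thus ?thesis using 1(3) vP by auto
  next
    case False
    hence c: "c < 0" using d2 2(1) by (cases "c = 0") auto
    define q where "q = t2 * (-c)"
    have q: "q > 0" using mult_pos_pos[of t2 "-c"] c tp unfolding q_def by linarith
    define x where "x = q / (t1 + q)"
    define y where "y = t1 / (t1 + q)"
    have xy: "x \<ge> 0" "y \<ge> 0" "x + y = 1" "x * t1 = y * q"
      using tp q by (simp_all add: x_def y_def flip: add_divide_distrib)
    have "x *\<^sub>R v1 + y *\<^sub>R v2 \<in> P"
      using xy by (intro convexD[OF cP vP(1,2)]) auto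
    also have "x *\<^sub>R v1 + y *\<^sub>R v2 = (x + y) *\<^sub>R z + (x * t1 - y * q) *\<^sub>R d1"
      unfolding t1 t2 d2 q_def by (simp add: algebra_simps)
    also have "\<dots> = z" using xy by simp
    finally show ?thesis using zP by simp
  qed
qed

lemma head_ex1: "convex_polygon P \<Longrightarrow> regular_point P z \<Longrightarrow> \<exists>!v. is_head P z v"
  using contact_ex1[of P z 1] by (simp add: is_head_def right_of_def)

lemma tail_ex1: "convex_polygon P \<Longrightarrow> regular_point P z \<Longrightarrow> \<exists>!v. is_tail P z v"
  using contact_ex1[of P z "-1"] by (simp add: is_tail_def left_of_def)

(* The k indices l 1, ..., l k, extended k-periodically to all integers; in particular
   the value at 0 is l k. *)
definition cyclic_index :: "nat \<Rightarrow> (nat \<Rightarrow> real) \<Rightarrow> int \<Rightarrow> real" where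
  "cyclic_index k l m = l (nat ((m - 1) mod int k) + 1)"

primrec forward_orbit ::
  "complex set \<Rightarrow> nat \<Rightarrow> (nat \<Rightarrow> real) \<Rightarrow> complex \<Rightarrow> nat \<Rightarrow> complex" where
  "forward_orbit P k l p 0 = p"
| "forward_orbit P k l p (Suc n) =
     (let z = forward_orbit P k l p n
      in refract (head P z) (cyclic_index k l (int (Suc n))) z)"

(* backward_orbit P k l p n is T^(-n) p, so the step from n to Suc n uses the index
   number m = -n. *)
primrec backward_orbit ::
  "complex set \<Rightarrow> nat \<Rightarrow> (nat \<Rightarrow> real) \<Rightarrow> complex \<Rightarrow> nat \<Rightarrow> complex" where
  "backward_orbit P k l p 0 = p"
| "backward_orbit P k l p (Suc n) =
     (let z = backward_orbit P k l p n
      in refract (tail P z) (1 / cyclic_index k l (- int n)) z)"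

(* These functions are total, with unspecified values after the orbit has met a point at
   which the map is undefined. Such orbits are excluded by strongly_regular, which
   demands that every point from which a step is taken be regular. *)
definition orbit ::
  "complex set \<Rightarrow> nat \<Rightarrow> (nat \<Rightarrow> real) \<Rightarrow> complex \<Rightarrow> int \<Rightarrow> complex" where
  "orbit P k l p m =
     (if m \<ge> 0 then forward_orbit P k l p (nat m) else backward_orbit P k l p (nat (- m)))"

definition strongly_regular ::
  "complex set \<Rightarrow> nat \<Rightarrow> (nat \<Rightarrow> real) \<Rightarrow> complex \<Rightarrow> bool" where
  "strongly_regular P k l p \<longleftrightarrow> (\<forall>m. regular_point P (orbit P k l p m))"

definition periodic_orbit ::
  "complex set \<Rightarrow> nat \<Rightarrow> (nat \<Rightarrow> real) \<Rightarrow> complex \<Rightarrow> bool" where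
  "periodic_orbit P k l p \<longleftrightarrow>
     (\<exists>N>0. \<forall>m. orbit P k l p (m + N) = orbit P k l p m \<and>
                cyclic_index k l (m + N) = cyclic_index k l m)"

end

theory Submission
  imports Defs
begin

text \<open>
  Put the origin inside \<open>P\<close>. Far away, the heads about points in a direction and in the opposite
  direction are two vertices \<open>A\<close> and \<open>A'\<close> that only depend on the sector of the direction, the sectors
  being bounded by rays parallel to the sides. Since the product of the indices is \<open>1\<close>, in such a sector
  \<open>T\<close> iterated \<open>2k\<close> times is the translation by \<open>W (A' - A)\<close>, where the constant \<open>W > 0\<close> only depends
  on the indices. Translation vectors of adjacent sectors differ by a multiple of the common ray \<open>u\<close>, so the
  points \<open>u / det (u, A' - A)\<close> are the corners of a centrally symmetric closed polygon whose sides are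
  parallel to the translation vectors. By simultaneous Diophantine approximation it can be scaled so that each
  side is almost an integer multiple of its translation vector. Using these integers as numbers of
  \<open>2k\<close>-step cycles, the translations cancel by central symmetry. The transition between two sectors tolerates
  an error in the corner smaller than the distance from the origin to the boundary of \<open>P\<close>, so the
  resulting closed chain is a genuine orbit.
\<close>

section \<open>Cross products and strict contact points\<close>

definition cross :: "complex \<Rightarrow> complex \<Rightarrow> real" where
  "cross a b = Re a * Im b - Im a * Re b"

lemma Im_cnj_mult: "Im (cnj a * b) = cross a b"
  by (simp add: cross_def)

lemma cross_add: "cross (a + b) c = cross a c + cross b c" "cross c (a + b) = cross c a + cross c b"
  and cross_diff: "cross (a - b) c = cross a c - cross b c" "cross c (a - b) = cross c a - cross c b"
  and cross_minus [simp]: "cross (- a) c = - cross a c" "cross c (- a) = - cross c a"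
  and cross_scaleR [simp]: "cross (t *\<^sub>R a) c = t * cross a c" "cross c (t *\<^sub>R a) = t * cross c a"
  and cross_self [simp]: "cross a a = 0"
  and cross_zero [simp]: "cross 0 a = 0" "cross a 0 = 0"
  by (simp_all add: cross_def algebra_simps)

lemmas cross_linear = cross_add cross_diff

lemma cross_commute: "cross a b = - cross b a"
  by (simp add: cross_def)

text \<open>If \<open>a \<bullet> p = 0\<close>, then up to the fixed factor
  \<open>cross p a\<close> the sign of \<open>cross p q\<close> is that of
  \<open>a \<bullet> q\<close>: it tells the sides of a line with normal \<open>a\<close>
  apart.\<close>

lemma cross_inner: "cross p q * (a \<bullet> a) = cross p a * (a \<bullet> q) + (a \<bullet> p) * cross a q"
  by (simp add: cross_def inner_complex_def algebra_simps)

lemma abs_cross_le: "\<bar>cross a b\<bar> \<le> norm a * norm b"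
  using abs_Im_le_cmod[of "cnj a * b"] by (simp add: Im_cnj_mult norm_mult del: times_complex.sel)

text \<open>The head for \<open>s = 1\<close> and the tail for \<open>s = -1\<close>; strictness makes \<open>v\<close> the only contact point.\<close>

definition strict_contact :: "real \<Rightarrow> complex set \<Rightarrow> complex \<Rightarrow> complex \<Rightarrow> bool" where
  "strict_contact s P z v \<longleftrightarrow> v \<in> P \<and> (\<forall>w\<in>P. w \<noteq> v \<longrightarrow> s * cross (v - z) (w - v) < 0)"

lemma convex_polygon_nonsingleton:
  assumes "convex_polygon P"
  obtains w where "w \<in> P" "w \<noteq> v"
proof -
  have "interior {v} = {}" by simp
  hence "\<not> P \<subseteq> {v}" using assms interior_mono[of P "{v}"] by (auto simp: convex_polygon_def)
  thus ?thesis using that by blast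
qed

text \<open>Testing \<open>w = z\<close> gives cross product 0. If \<open>z = v\<close>, all cross
  products vanish, and a second point of \<open>P\<close> contradicts strictness.\<close>

lemma strict_contact_not_in:
  assumes "convex_polygon P" "strict_contact s P z v"
  shows "z \<notin> P"
proof
  assume z: "z \<in> P"
  obtain w where w: "w \<in> P" "w \<noteq> v" by (rule convex_polygon_nonsingleton[OF assms(1)])
  show False
  proof (cases "z = v")
    case True thus False using w assms(2) by (auto simp: strict_contact_def)
  next
    case False
    hence "s * cross (v - z) (z - v) < 0" using z assms(2) by (simp add: strict_contact_def)
    thus False by (simp add: cross_linear cross_commute[of v z])
  qed
qed

text \<open>\<open>s * cross (v - z)\<close> is linear and attains its maximum over \<open>P\<close>
  only at \<open>v\<close>; it is constant on the line through \<open>z\<close> and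
  \<open>v\<close>.\<close>

lemma strict_contact_props:
  assumes P: "convex_polygon P" and c: "strict_contact s P z v"
  shows "v extreme_point_of P" "v - z \<noteq> 0"
    "\<And>w. w \<in> P \<Longrightarrow> s * cross (v - z) (w - z) \<le> 0" "ray z (v - z) \<inter> P = {v}"
proof -
  have v: "v \<in> P" and neg: "\<And>w. w \<in> P \<Longrightarrow> w \<noteq> v \<Longrightarrow> s * cross (v - z) (w - v) < 0"
    using c by (auto simp: strict_contact_def)
  show "v extreme_point_of P"
    unfolding extreme_point_of_def
  proof (intro conjI ballI notI)
    fix a b assume ab: "a \<in> P" "b \<in> P" "v \<in> open_segment a b"
    then obtain u where u: "a \<noteq> b" "0 < u" "u < 1" "v = (1 - u) *\<^sub>R a + u *\<^sub>R b"
      by (auto simp: in_segment)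
    have "a \<noteq> v" "b \<noteq> v" using ab(3) by (auto simp: open_segment_def)
    hence "(1 - u) * (s * cross (v - z) (a - v)) < 0" "u * (s * cross (v - z) (b - v)) < 0"
      using neg ab u by (simp_all add: mult_less_0_iff)
    moreover have "(1 - u) * (s * cross (v - z) (a - v)) + u * (s * cross (v - z) (b - v))
        = s * cross (v - z) ((1 - u) *\<^sub>R a + u *\<^sub>R b - v)"
      by (simp add: cross_linear algebra_simps)
    moreover have "(1 - u) *\<^sub>R a + u *\<^sub>R b - v = 0" using u(4) by simp
    ultimately show False by simp
  qed (fact v)
  show "v - z \<noteq> 0" using v strict_contact_not_in[OF P c] by auto
  show "s * cross (v - z) (w - z) \<le> 0" if "w \<in> P" for w
  proof -
    have "w - z = (w - v) + (v - z)" by simp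
    hence "cross (v - z) (w - z) = cross (v - z) (w - v)"
      by (metis cross_add(2) cross_self add.right_neutral)
    thus ?thesis using neg[OF that] by (cases "w = v") auto
  qed
  have "w = v" if "w \<in> ray z (v - z)" "w \<in> P" for w
  proof (rule ccontr)
    assume "w \<noteq> v"
    from that(1) obtain t where t: "w = z + t *\<^sub>R (v - z)" by (auto simp: ray_def)
    have "w - v = (t - 1) *\<^sub>R (v - z)" by (simp add: t algebra_simps)
    hence "cross (v - z) (w - v) = 0" by (metis cross_scaleR(2) cross_self mult_zero_right)
    thus False using neg[OF that(2) \<open>w \<noteq> v\<close>] by simp
  qed
  moreover have "v \<in> ray z (v - z)" by (auto simp: ray_def intro!: exI[of _ 1])
  ultimately show "ray z (v - z) \<inter> P = {v}" using v by blast
qed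

lemma strict_contact_is_head:
  "convex_polygon P \<Longrightarrow> strict_contact 1 P z v \<Longrightarrow> is_head P z v"
  using strict_contact_props[of P 1 z v]
  by (auto simp: is_head_def right_of_def Im_cnj_mult simp del: times_complex.sel intro!: exI[of _ "v - z"])

lemma strict_contact_is_tail:
  "convex_polygon P \<Longrightarrow> strict_contact (-1) P z v \<Longrightarrow> is_tail P z v"
  using strict_contact_props[of P "-1" z v]
  by (auto simp: is_tail_def left_of_def Im_cnj_mult simp del: times_complex.sel intro!: exI[of _ "v - z"])

text \<open>If a side line passed through \<open>z\<close>, then \<open>P\<close> would lie weakly on one side of it, whereas the
  strict head and the strict tail lie strictly on different sides.\<close>

lemma strict_contacts_regular:
  assumes P: "convex_polygon P" and h: "strict_contact 1 P z v" and t: "strict_contact (-1) P z v'"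
  shows "regular_point P z"
  unfolding regular_point_def
proof (intro conjI allI impI notI)
  have zP: "z \<notin> P" by (rule strict_contact_not_in[OF P h])
  then show "z \<in> P \<Longrightarrow> False" by simp
  fix e assume e: "e edge_of P" and ze: "z \<in> affine hull e"
  have ef: "e face_of P" "aff_dim e = 1" using e by (auto simp: edge_of_def)
  have "polyhedron P" using P by (simp add: convex_polygon_def polytope_imp_polyhedron)
  then obtain a b where ab: "P \<subseteq> {x. a \<bullet> x \<le> b}" "e = P \<inter> {x. a \<bullet> x = b}"
    using ef(1) exposed_face_of_polyhedron[of P e] by (auto simp: exposed_face_of_def)
  have "aff_dim P = 2" using P aff_dim_nonempty_interior[of P] by (simp add: convex_polygon_def)
  hence "e \<noteq> P" using ef by auto
  have ne: "e \<noteq> {}" using ef by auto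
  have a0: "a \<noteq> 0"
  proof
    assume "a = 0" thus False using ab \<open>e \<noteq> P\<close> ne by (auto split: if_splits)
  qed
  have "affine hull e \<subseteq> {x. a \<bullet> x = b}" using ab(2) by (intro hull_minimal affine_hyperplane) auto
  hence zb: "a \<bullet> z = b" using ze by auto
  have contact: "cross (v - z) (w - z) < 0" if "w \<in> P" "w \<noteq> v" for w
  proof -
    have "w - v = (w - z) - (v - z)" by simp
    hence "cross (v - z) (w - v) = cross (v - z) (w - z)" by (metis cross_diff(2) cross_self diff_zero)
    thus ?thesis using h that by (auto simp: strict_contact_def)
  qed
  have contact': "cross (v' - z) (w - z) > 0" if "w \<in> P" "w \<noteq> v'" for w
  proof -
    have "w - v' = (w - z) - (v' - z)" by simp
    hence "cross (v' - z) (w - v') = cross (v' - z) (w - z)" by (metis cross_diff(2) cross_self diff_zero)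
    thus ?thesis using t that by (auto simp: strict_contact_def)
  qed
  have line: "cross (x - z) (y - z) = 0" if "x \<in> e" "y \<in> e" for x y
    using cross_inner[of "x - z" "y - z" a] that ab(2) zb a0 by (auto simp: inner_diff_right)
  have "\<not> e \<subseteq> {x}" for x
  proof
    assume "e \<subseteq> {x}"
    hence "e = {x}" using ne by auto
    thus False using ef(2) by simp
  qed
  then obtain w where "w \<in> e" by auto
  then obtain w' where w': "w' \<in> e" "w' \<noteq> w" using \<open>\<not> e \<subseteq> {w}\<close> by auto
  \<comment> \<open>\<open>e\<close> has a second point \<open>y\<close> with \<open>y - z\<close>
    parallel to \<open>x - z\<close>, so \<open>x\<close> is not a strict contact.\<close>
  have neq: "x \<noteq> v" "x \<noteq> v'" if "x \<in> e" for x
  proof -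
    obtain y where y: "y \<in> e" "y \<noteq> x" using \<open>\<And>x. \<not> e \<subseteq> {x}\<close> by blast
    hence "y \<in> P" using ab by auto
    thus "x \<noteq> v" "x \<noteq> v'" using contact[of y] contact'[of y] line[OF that y(1)] y by auto
  qed
  have "w \<in> P" using \<open>w \<in> e\<close> ab by auto
  have 1: "cross (w - z) (v - z) > 0"
    using contact[OF \<open>w \<in> P\<close>] neq[OF \<open>w \<in> e\<close>] cross_commute[of "v - z" "w - z"] by linarith
  have 2: "cross (w - z) (v' - z) < 0"
    using contact'[OF \<open>w \<in> P\<close>] neq[OF \<open>w \<in> e\<close>] cross_commute[of "v' - z" "w - z"] by linarith
  have vP: "v \<in> P" "v' \<in> P" using h t by (auto simp: strict_contact_def)
  have aa: "a \<bullet> a > 0" using a0 by simp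
  have le: "a \<bullet> (v - z) \<le> 0" "a \<bullet> (v' - z) \<le> 0"
    using vP ab(1) zb by (auto simp: inner_diff_right)
  have a_w: "a \<bullet> (w - z) = 0" using \<open>w \<in> e\<close> ab zb by (simp add: inner_diff_right)
  \<comment> \<open>\<open>cross (w - z) a\<close> is one fixed number and \<open>v\<close>,
    \<open>v'\<close> lie weakly on one side of the line, so these products cannot have opposite
    signs.\<close>
  have "cross (w - z) a * (a \<bullet> (v - z)) > 0"
    using cross_inner[of "w - z" "v - z" a] a_w mult_pos_pos[OF 1 aa] by simp
  moreover have "cross (w - z) a * (a \<bullet> (v' - z)) < 0"
    using cross_inner[of "w - z" "v' - z" a] a_w mult_neg_pos[OF 2 aa] by simp
  ultimately show False using le by (simp add: zero_less_mult_iff mult_less_0_iff)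
qed

text \<open>The image lies beyond \<open>v\<close> on the same line, so the direction towards
  \<open>v\<close> is reversed and a head becomes a tail.\<close>

lemma strict_contact_refract:
  assumes "strict_contact s P z v" "l > 0"
  shows "strict_contact (- s) P (refract v l z) v"
proof -
  have "v - refract v l z = - (l *\<^sub>R (v - z))" by (simp add: refract_def)
  hence "- s * cross (v - refract v l z) (w - v) = l * (s * cross (v - z) (w - v))" for w
    by simp
  thus ?thesis
    using assms by (auto simp: strict_contact_def mult_less_0_iff)
qed

section \<open>Recognising a two-sided sequence as an orbit\<close>

lemma refract_inverse: "l \<noteq> 0 \<Longrightarrow> refract v (1 / l) (refract v l z) = z"
  by (simp add: refract_def algebra_simps)

text \<open>Only heads have to be supplied: the head of one point is the tail of the next, which
  gives regularity and makes the backward orbit retrace \<open>z\<close>.\<close>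

lemma orbit_eq:
  assumes P: "convex_polygon P" and lpos: "\<And>m. cyclic_index k l m > 0"
    and head: "\<And>m. strict_contact 1 P (z m) (A m)"
    and step: "\<And>m. z (m + 1) = refract (A m) (cyclic_index k l (m + 1)) (z m)"
  shows "orbit P k l (z 0) m = z m" and "regular_point P (z m)"
proof -
  have tail: "strict_contact (-1) P (z m) (A (m - 1))" for m
    using strict_contact_refract[OF head[of "m - 1"] lpos[of m]] step[of "m - 1"] by simp
  have reg: "regular_point P (z m)" for m
    by (rule strict_contacts_regular[OF P head tail])
  show "regular_point P (z m)" by (rule reg)
  have hd: "head P (z m) = A m" for m
    unfolding Defs.head_def
    by (rule the1_equality[OF head_ex1[OF P reg] strict_contact_is_head[OF P head]])
  have tl: "tail P (z m) = A (m - 1)" for m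
    unfolding tail_def
    by (rule the1_equality[OF tail_ex1[OF P reg] strict_contact_is_tail[OF P tail]])
  have fw: "forward_orbit P k l (z 0) n = z (int n)" for n
  proof (induction n)
    case (Suc n)
    thus ?case using step[of "int n"] by (simp add: hd add.commute)
  qed simp
  have bw: "backward_orbit P k l (z 0) n = z (- int n)" for n
  proof (induction n)
    case (Suc n)
    have "z (- int n) = refract (A (- int n - 1)) (cyclic_index k l (- int n)) (z (- int n - 1))"
      using step[of "- int n - 1"] by simp
    hence "refract (A (- int n - 1)) (1 / cyclic_index k l (- int n)) (z (- int n)) = z (- int n - 1)"
      using refract_inverse lpos[of "- int n"] by (metis less_irrefl)
    hence "backward_orbit P k l (z 0) (Suc n) = z (- int n - 1)" using Suc tl[of "- int n"] by simp
    also have "- int n - 1 = - int (Suc n)" by simp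
    finally show ?case .
  qed simp
  show "orbit P k l (z 0) m = z m"
    using fw[of "nat m"] bw[of "nat (- m)"] by (simp add: orbit_def)
qed

section \<open>Motion within one sector\<close>

text \<open>\<open>x\<close> is a positive combination of \<open>u\<close> and \<open>u'\<close>,
  and \<open>d \<noteq> 0\<close> cannot be parallel to both.\<close>

lemma cross_cone:
  assumes "cross u u' > 0" "cross u x > 0" "cross u' x < 0" "cross u d \<ge> 0" "cross u' d \<ge> 0" "d \<noteq> 0"
  shows "cross x d > 0"
proof -
  have id: "cross u u' * cross x d = (- cross u' x) * cross u d + cross u x * cross u' d"
    by (simp add: cross_def algebra_simps)
  have "cross u d \<noteq> 0 \<or> cross u' d \<noteq> 0"
  proof (rule ccontr)
    assume *: "\<not> ?thesis"
    have "cross u u' *\<^sub>R d = cross u d *\<^sub>R u' - cross u' d *\<^sub>R u"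
      by (simp add: cross_def complex_eq_iff algebra_simps)
    thus False using * assms by simp
  qed
  moreover have nn: "(- cross u' x) * cross u d \<ge> 0" "cross u x * cross u' d \<ge> 0"
    using assms by (simp_all add: mult_nonpos_nonneg)
  moreover have "(- cross u' x) * cross u d \<noteq> 0 \<or> cross u x * cross u' d \<noteq> 0"
    using calculation(1) assms(2,3) by simp
  ultimately have "(- cross u' x) * cross u d + cross u x * cross u' d > 0" by linarith
  hence "cross u u' * cross x d > 0" using id by (simp only:)
  thus ?thesis using assms(1) by (simp add: zero_less_mult_iff)
qed

text \<open>The time is part of the state because it selects the index; as a relation, phases can be
  joined by transitivity.\<close>

definition billiard_steps :: "complex set \<Rightarrow> (nat \<Rightarrow> real) \<Rightarrow> ((nat \<times> complex) \<times> (nat \<times> complex)) set" where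
  "billiard_steps P lam =
     {((m, z), (Suc m, refract v (lam (Suc m)) z)) | m z v. strict_contact 1 P z v}"

definition cumprod :: "(nat \<Rightarrow> real) \<Rightarrow> nat \<Rightarrow> real" where
  "cumprod lam r = (\<Prod>j=1..r. lam j)"

text \<open>The distance, in units of \<open>A' - A\<close>, covered in \<open>r\<close> steps by
  the rescaled point of \<open>billiard_phase\<close>.\<close>

definition cumsum :: "(nat \<Rightarrow> real) \<Rightarrow> nat \<Rightarrow> real" where
  "cumsum lam r = (\<Sum>j=1..r. 1 / cumprod lam j)"

lemma cumprod_simps [simp]: "cumprod lam 0 = 1" "cumprod lam (Suc r) = cumprod lam r * lam (Suc r)"
  by (simp_all add: cumprod_def)

lemma cumsum_simps [simp]: "cumsum lam 0 = 0" "cumsum lam (Suc r) = cumsum lam r + 1 / cumprod lam (Suc r)"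
  by (simp_all add: cumsum_def)

text \<open>An even period restores both the sign \<open>(-1) ^ r\<close> and the alternation of the
  two contact points.\<close>

locale periodic_indices =
  fixes lam :: "nat \<Rightarrow> real" and K :: nat
  assumes lam_pos: "lam j > 0" and lam_per: "lam (Suc j + K) = lam (Suc j)"
    and K_even: "even K" and K_pos: "K > 0" and prod_1: "cumprod lam K = 1"
begin

lemma cumprod_pos: "cumprod lam r > 0"
  by (induction r) (simp_all add: lam_pos)

lemma cumprod_per: "cumprod lam (r + K) = cumprod lam r"
proof (induction r)
  case (Suc r)
  thus ?case using lam_per[of r] by simp
qed (simp add: prod_1)

lemma cumprod_mult: "cumprod lam (K * N) = 1"
proof (induction N)
  case (Suc N)
  thus ?case using cumprod_per[of "K * N"] by (simp add: add.commute)
qed simp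

lemma lam_mult: "lam (Suc j + K * N) = lam (Suc j)"
proof (induction N)
  case (Suc N)
  thus ?case using lam_per[of "j + K * N"] by (simp add: ac_simps)
qed simp

lemma cumsum_per: "cumsum lam (r + K) = cumsum lam r + cumsum lam K"
proof (induction r)
  case (Suc r)
  thus ?case using cumprod_per[of "Suc r"] by simp
qed simp

lemma cumsum_mult: "cumsum lam (K * N) = real N * cumsum lam K"
proof (induction N)
  case (Suc N)
  thus ?case using cumsum_per[of "K * N"] by (simp add: algebra_simps)
qed simp

lemma cumsum_nonneg: "cumsum lam r \<ge> 0"
  unfolding cumsum_def using cumprod_pos by (intro sum_nonneg) (auto simp: less_imp_le)

text \<open>The last summand of the full sum is \<open>1 / cumprod lam (K * N) = 1\<close>, so every
  earlier partial sum is short by at least 1.\<close>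

lemma cumsum_le:
  assumes "r < K * N" shows "cumsum lam r \<le> real N * cumsum lam K - 1"
proof -
  have mono: "cumsum lam r \<le> cumsum lam (r + d)" for d
    by (induction d) (use cumprod_pos in \<open>auto simp: less_imp_le simp del: cumprod_simps intro: add_increasing2\<close>)
  obtain q where q: "K * N = Suc q" using assms by (cases "K * N") auto
  have "cumsum lam r \<le> cumsum lam q" using mono[of "q - r"] assms q by simp
  moreover have "cumsum lam (K * N) = cumsum lam q + 1"
    using cumprod_mult[of N] by (simp add: q del: cumprod_simps)
  ultimately show ?thesis by (simp add: cumsum_mult)
qed

lemma cumsum_K_pos: "cumsum lam K > 0"
  using cumsum_le[of 0 1] K_pos by simp

text \<open>The orbit is written as \<open>(-1)^r \<Lambda>\<^sub>r x\<^sub>r + B\<^sub>r\<close>, where \<open>\<Lambda>\<^sub>r\<close> is the product of the first \<open>r\<close> indices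
  and the contact points \<open>B\<^sub>r\<close> alternate between \<open>A\<close> and \<open>A'\<close>; then \<open>x\<^sub>r\<close> moves along a line in
  the direction \<open>A' - A\<close>. The contact points stay the same as long as \<open>x\<^sub>r\<close> remains in the
  open cone spanned by \<open>u\<close> and \<open>u'\<close>.\<close>

lemma billiard_phase:
  assumes uu: "cross u u' > 0"
    and A: "A \<in> P" "\<And>w. w \<in> P \<Longrightarrow> cross u (w - A) \<ge> 0" "\<And>w. w \<in> P \<Longrightarrow> cross u' (w - A) \<ge> 0"
    and A': "A' \<in> P" "\<And>w. w \<in> P \<Longrightarrow> cross u (w - A') \<le> 0" "\<And>w. w \<in> P \<Longrightarrow> cross u' (w - A') \<le> 0"
    and Y': "Y' = Y + (real N * cumsum lam K) *\<^sub>R (A' - A)"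
    and start: "cross u (Y - A) > 0" and stop: "cross u' (Y' - A') < 0"
  shows "((K * M, Y), (K * M + K * N, Y')) \<in> (billiard_steps P lam)\<^sup>*"
proof -
  define \<delta> where "\<delta> = A' - A"
  define x where "x r = Y - A + cumsum lam r *\<^sub>R \<delta>" for r
  define B where "B r = (if even r then A else A')" for r :: nat
  define z where "z r = ((-1) ^ r * cumprod lam r) *\<^sub>R x r + B r" for r
  have \<delta>: "cross u \<delta> \<ge> 0" "cross u' \<delta> \<ge> 0" unfolding \<delta>_def using A(2,3)[OF A'(1)] by auto
  have z_step: "z (Suc r) = refract (B r) (lam (Suc r)) (z r)" for r
  proof -
    have "cumprod lam (Suc r) *\<^sub>R x (Suc r) = cumprod lam (Suc r) *\<^sub>R x r + \<delta>"
      using cumprod_pos[of "Suc r"] by (simp add: x_def algebra_simps del: cumprod_simps)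
    hence "((-1) ^ Suc r * cumprod lam (Suc r)) *\<^sub>R x (Suc r) = (-1) ^ Suc r *\<^sub>R (cumprod lam (Suc r) *\<^sub>R x r + \<delta>)"
      by (metis scaleR_scaleR)
    also have "\<dots> = ((-1) ^ Suc r * cumprod lam (Suc r)) *\<^sub>R x r + (-1) ^ Suc r *\<^sub>R \<delta>"
      by (simp add: algebra_simps)
    finally show ?thesis
      by (auto simp: z_def refract_def B_def \<delta>_def algebra_simps)
  qed
  have contact: "strict_contact 1 P (z r) (B r)" if r: "r < K * N" for r
  proof -
    have x1: "cross u (x r) > 0"
      unfolding x_def using start \<delta>(1) cumsum_nonneg[of r]
      by (subst cross_add) (simp add: add_pos_nonneg)
    \<comment> \<open>Replacing \<open>A\<close> by \<open>A'\<close> costs one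
      \<open>\<delta>\<close>, exactly the slack 1 in \<open>cumsum_le\<close>.\<close>
    have "x r = (Y' - A') - (real N * cumsum lam K - 1 - cumsum lam r) *\<^sub>R \<delta>"
      unfolding x_def Y' \<delta>_def by (simp add: algebra_simps)
    moreover have "(real N * cumsum lam K - 1 - cumsum lam r) * cross u' \<delta> \<ge> 0"
      using cumsum_le[OF r] \<delta>(2) by simp
    ultimately have "cross u' (x r) = cross u' (Y' - A') - (real N * cumsum lam K - 1 - cumsum lam r) * cross u' \<delta>"
      by (metis cross_diff(2) cross_scaleR(2))
    hence x2: "cross u' (x r) < 0"
      using stop \<open>(real N * cumsum lam K - 1 - cumsum lam r) * cross u' \<delta> \<ge> 0\<close> by linarith
    have "cross (B r - z r) (w - B r) < 0" if w: "w \<in> P" "w \<noteq> B r" for w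
    proof (cases "even r")
      case True
      have "cross (x r) (w - A) > 0"
        using w True A(2,3)[OF w(1)] by (intro cross_cone[OF uu x1 x2]) (auto simp: B_def)
      moreover have "B r - z r = - (cumprod lam r *\<^sub>R x r)" using True by (simp add: z_def)
      ultimately show ?thesis using True cumprod_pos[of r] by (simp add: B_def)
    next
      case False
      have "cross (x r) (A' - w) > 0"
        using w False A'(2,3)[OF w(1)] by (intro cross_cone[OF uu x1 x2]) (auto simp: B_def cross_diff)
      moreover have "B r - z r = cumprod lam r *\<^sub>R x r" using False by (simp add: z_def)
      ultimately show ?thesis using False cumprod_pos[of r]
        by (simp add: B_def mult_less_0_iff cross_diff)
    qed
    thus ?thesis using A(1) A'(1) by (auto simp: strict_contact_def B_def)
  qed
  have "((K * M, z 0), (K * M + r, z r)) \<in> (billiard_steps P lam)\<^sup>*" if "r \<le> K * N" for r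
    using that
  proof (induction r)
    case (Suc r)
    \<comment> \<open>The phase starts at a multiple of the period, so its indices are those from
      time 0.\<close>
    have "lam (Suc (K * M + r)) = lam (Suc r)" using lam_mult[of r M] by (simp add: add.commute)
    hence "((K * M + r, z r), (K * M + Suc r, z (Suc r))) \<in> billiard_steps P lam"
      using contact[of r] Suc.prems
      by (auto simp: billiard_steps_def z_step intro!: exI[of _ "B r"])
    thus ?case using Suc by (meson Suc_leD rtrancl.rtrancl_into_rtrancl)
  qed simp
  moreover have "z 0 = Y" by (simp add: z_def x_def B_def)
  moreover have "z (K * N) = Y'"
    using K_even by (simp add: z_def x_def B_def cumprod_mult cumsum_mult Y' \<delta>_def)
  ultimately show ?thesis by auto
qed

end

section \<open>Critical directions and sectors\<close>

lemma cross_cis: "cross (cis a) (cis b) = sin (b - a)"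
  by (simp add: cross_def sin_diff algebra_simps)

lemma sin_eq_0_small: "sin x = 0 \<Longrightarrow> \<bar>x\<bar> < pi \<Longrightarrow> x = (0::real)"
  by (metis sin_eq_0_pi abs_less_iff minus_less_iff)

text \<open>Two directions parallel to \<open>d\<close> are parallel to each other, so the half-open
  half-turn contains at most one.\<close>

lemma finite_parallel_angles:
  assumes "d \<noteq> 0"
  shows "finite {\<theta>. 0 \<le> \<theta> \<and> \<theta> < pi \<and> cross (cis \<theta>) d = 0}" (is "finite ?S")
proof -
  have eq: "x = y" if "x \<in> ?S" "y \<in> ?S" for x y
  proof -
    have "cross (cis x) (cis y) *\<^sub>R d = cross (cis x) d *\<^sub>R cis y - cross (cis y) d *\<^sub>R cis x"
      by (simp add: cross_def complex_eq_iff algebra_simps)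
    hence "sin (y - x) = 0" using that assms by (simp add: cross_cis)
    moreover have "\<bar>y - x\<bar> < pi" using that by auto
    ultimately show ?thesis using sin_eq_0_small by fastforce
  qed
  show ?thesis
  proof (cases "?S = {}")
    case False
    then obtain x where "x \<in> ?S" by blast
    hence "?S \<subseteq> {x}" using eq by blast
    thus ?thesis using finite_subset by blast
  next
    case True
    show ?thesis unfolding True by simp
  qed
qed

lemma cis_add_pi: "cis (x + pi) = - cis x" "cis (x - pi) = - cis x"
  by (simp_all add: complex_eq_iff)

lemma angle_mod_pi:
  assumes "0 \<le> \<theta>"
  obtains q :: nat where "real q * pi \<le> \<theta>" "\<theta> < real q * pi + pi"
proof -
  define q where "q = nat \<lfloor>\<theta> / pi\<rfloor>"
  have "0 \<le> \<theta> / pi" using assms by simp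
  hence "real q \<le> \<theta> / pi" "\<theta> / pi < real q + 1" unfolding q_def by linarith+
  thus ?thesis using that[of q] by (simp add: field_simps)
qed

lemma cis_diff_multiple_pi: "cis (\<theta> - real q * pi) = cis \<theta> \<or> cis (\<theta> - real q * pi) = - cis \<theta>"
proof (induction q)
  case (Suc q)
  have "\<theta> - real (Suc q) * pi = (\<theta> - real q * pi) - pi" by (simp add: algebra_simps)
  thus ?case using Suc cis_add_pi(2) by (metis minus_minus)
qed simp

text \<open>The angles \<open>a i\<close> enumerate the directions that are parallel to a difference of two points of \<open>V\<close>;
  \<open>0\<close> and \<open>pi/2\<close> are added to make consecutive angles differ by less than \<open>pi\<close>.\<close>

lemma critical_angles:
  assumes "finite V"
  obtains n :: nat and a :: "nat \<Rightarrow> real"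
  where "n > 0" "\<And>i. a (i + n) = a i + pi" "\<And>i. a i < a (Suc i)" "\<And>i. a (Suc i) < a i + pi"
    "\<And>v w i \<theta>. v \<in> V \<Longrightarrow> w \<in> V \<Longrightarrow> v \<noteq> w \<Longrightarrow> a i < \<theta> \<Longrightarrow> \<theta> < a (Suc i) \<Longrightarrow> cross (cis \<theta>) (w - v) \<noteq> 0"
proof -
  define S where "S = {0, pi / 2} \<union>
    (\<Union>(v, w) \<in> (V \<times> V) - Id. {\<theta>. 0 \<le> \<theta> \<and> \<theta> < pi \<and> cross (cis \<theta>) (w - v) = 0})"
  have fin: "finite S"
    unfolding S_def using assms by (auto intro!: finite_parallel_angles)
  have S_bounds: "0 \<le> x" "x < pi" if "x \<in> S" for x
    using that by (auto simp: S_def) (use pi_gt_zero in linarith)+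
  define L where "L = sorted_list_of_set S"
  define n where "n = length L"
  have L: "set L = S" "sorted_wrt (<) L" using fin by (auto simp: L_def)
  have n: "n = card S" by (simp add: n_def L_def)
  have "card {0, pi / 2} \<le> card S" by (rule card_mono[OF fin]) (auto simp: S_def)
  hence n2: "n \<ge> 2" by (simp add: n)
  have L_mem: "L ! j \<in> S" if "j < n" for j using L that by (auto simp: n_def)
  have L_less: "L ! i < L ! j" if "i < j" "j < n" for i j
    using L(2) that by (simp add: sorted_wrt_iff_nth_less n_def)
  \<comment> \<open>Parallelism to a vector has period \<open>pi\<close>, so the list is continued
    by adding multiples of \<open>pi\<close>.\<close>
  define a where "a i = L ! (i mod n) + real (i div n) * pi" for i
  have a_n: "a (i + n) = a i + pi" for i using n2 by (simp add: a_def algebra_simps)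
  have a_Suc: "a i < a (Suc i) \<and> a (Suc i) < a i + pi" for i
  proof (cases "Suc (i mod n) = n")
    case True
    hence *: "Suc i mod n = 0" "Suc i div n = Suc (i div n)" by (auto simp: mod_Suc div_Suc)
    have "L ! 0 < L ! (i mod n)" using True n2 by (intro L_less) auto
    moreover have "L ! (i mod n) < pi" "L ! 0 \<ge> 0" using n2 by (auto intro!: S_bounds L_mem)
    ultimately show ?thesis unfolding a_def * by (simp add: algebra_simps)
  next
    case False
    hence lt: "Suc (i mod n) < n" using n2 by (simp add: Suc_lessI)
    hence *: "Suc i mod n = Suc (i mod n)" "Suc i div n = i div n" by (auto simp: mod_Suc div_Suc)
    have "L ! (i mod n) < L ! Suc (i mod n)" using lt by (intro L_less) auto
    moreover have "L ! Suc (i mod n) < pi" "L ! (i mod n) \<ge> 0" using lt by (auto intro!: S_bounds L_mem)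
    ultimately show ?thesis unfolding a_def * by simp
  qed
  have mono: "strict_mono a" using a_Suc by (simp add: strict_mono_Suc_iff)
  have a_nonneg: "a i \<ge> 0" for i
    using S_bounds(1)[OF L_mem, of "i mod n"] n2 by (simp add: a_def)
  have hit: "\<exists>j. \<theta> = a j" if vw: "v \<in> V" "w \<in> V" "v \<noteq> w" and \<theta>: "0 \<le> \<theta>" "cross (cis \<theta>) (w - v) = 0" for v w \<theta>
  proof -
    obtain q where q: "real q * pi \<le> \<theta>" "\<theta> < real q * pi + pi" by (rule angle_mod_pi[OF \<theta>(1)])
    have "cross (cis (\<theta> - real q * pi)) (w - v) = 0"
      using cis_diff_multiple_pi[of \<theta> q] \<theta>(2) by auto
    hence "\<theta> - real q * pi \<in> S" unfolding S_def using vw q by auto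
    then obtain j where "j < n" "L ! j = \<theta> - real q * pi" using L(1) by (auto simp: in_set_conv_nth n_def)
    hence "a (j + n * q) = \<theta>" by (simp add: a_def)
    thus ?thesis by blast
  qed
  show ?thesis
  proof (rule that[of n a])
    fix v w i \<theta> assume *: "v \<in> V" "w \<in> V" "v \<noteq> w" "a i < \<theta>" "\<theta> < a (Suc i)"
    show "cross (cis \<theta>) (w - v) \<noteq> 0"
    proof
      assume "cross (cis \<theta>) (w - v) = 0"
      moreover have "0 \<le> \<theta>" using a_nonneg[of i] *(4) by linarith
      ultimately obtain j where "\<theta> = a j" using hit[OF *(1-3)] by blast
      thus False using * mono by (simp add: strict_mono_less)
    qed
  qed (use n2 a_n a_Suc in auto)
qed

text \<open>Here \<open>A i\<close> is the head of \<open>P\<close> about the far away points in the open sector between the directions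
  \<open>u i\<close> and \<open>u (Suc i)\<close>, and hence \<open>A (i + n)\<close> is the head about the points in the opposite sector.\<close>

lemma sectors:
  assumes fin: "finite V" and P: "P = convex hull V" and V: "V \<noteq> {}"
  obtains n :: nat and u :: "nat \<Rightarrow> complex" and A :: "nat \<Rightarrow> complex"
  where "n > 0" "\<And>i. norm (u i) = 1" "\<And>i. u (i + n) = - u i" "\<And>i. cross (u i) (u (Suc i)) > 0"
    "\<And>i. A i \<in> P" "\<And>i. A (i + n + n) = A i"
    "\<And>i w. w \<in> P \<Longrightarrow> cross (u i) (w - A i) \<ge> 0"
    "\<And>i w. w \<in> P \<Longrightarrow> cross (u (Suc i)) (w - A i) \<ge> 0"
proof -
  obtain n :: nat and a :: "nat \<Rightarrow> real"
  where n: "n > 0" and a_n: "\<And>i. a (i + n) = a i + pi" and a_Suc: "\<And>i. a i < a (Suc i)"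
    and a_gap: "\<And>i. a (Suc i) < a i + pi"
    and noncrit: "\<And>v w i \<theta>. v \<in> V \<Longrightarrow> w \<in> V \<Longrightarrow> v \<noteq> w \<Longrightarrow> a i < \<theta> \<Longrightarrow> \<theta> < a (Suc i) \<Longrightarrow> cross (cis \<theta>) (w - v) \<noteq> 0"
    by (rule critical_angles[OF fin]) blast
  define mid where "mid i = (a i + a (Suc i)) / 2" for i
  \<comment> \<open>The choice depends on the direction alone, so angles differing by
    \<open>2 * pi\<close> give the same vertex.\<close>
  define h where "h e = (SOME v. v \<in> V \<and> (\<forall>w\<in>V. cross e v \<le> cross e w))" for e
  define A where "A i = h (cis (mid i))" for i
  have "\<exists>v. v \<in> V \<and> (\<forall>w\<in>V. cross e v \<le> cross e w)" for e
  proof -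
    have "\<exists>v\<in>V. \<forall>w\<in>V. cross e v \<le> cross e w"
      using ex_is_arg_min_if_finite[OF fin V, of "cross e"] by (auto simp: is_arg_min_linorder)
    thus ?thesis by blast
  qed
  from someI_ex[OF this] have h: "h e \<in> V" "\<And>w. w \<in> V \<Longrightarrow> cross e (h e) \<le> cross e w" for e
    unfolding h_def by blast+
  have mid: "a i < mid i" "mid i < a (Suc i)" for i using a_Suc[of i] by (auto simp: mid_def)
  have A_V: "A i \<in> V" for i by (simp add: A_def h)
  have cont: "continuous_on X (\<lambda>\<theta>. cross (cis \<theta>) d)" for X d
    unfolding cross_def by (auto intro!: continuous_intros)
  \<comment> \<open>The inequality holds at \<open>mid i\<close> by minimality. A sign change would
    give a zero inside the open sector, hence a critical angle there.\<close>
  have weak: "cross (cis \<theta>) (w - A i) \<ge> 0" if w: "w \<in> V" and \<theta>: "a i \<le> \<theta>" "\<theta> \<le> a (Suc i)" for w i \<theta>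
  proof (rule ccontr)
    assume neg: "\<not> ?thesis"
    define f where "f \<theta> = cross (cis \<theta>) (w - A i)" for \<theta>
    have f: "f \<theta> < 0" "f (mid i) \<ge> 0" "w \<noteq> A i" 
      using neg h(2)[OF w, of "cis (mid i)"] by (auto simp: f_def A_def cross_diff)
    have fm: "f (mid i) > 0" using f noncrit[OF A_V w, where i = i and \<theta> = "mid i"] mid[of i] by (auto simp: f_def less_le)
    have "\<exists>x. (\<theta> < x \<and> x < mid i \<or> mid i < x \<and> x < \<theta>) \<and> f x = 0"
    proof (cases "\<theta> \<le> mid i")
      case True
      then obtain x where x: "\<theta> \<le> x" "x \<le> mid i" "f x = 0"
        using IVT'[of f \<theta> 0 "mid i"] f cont unfolding f_def by (auto simp: less_imp_le)
      moreover from x f fm have "x \<noteq> \<theta>" "x \<noteq> mid i" by auto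
      ultimately show ?thesis by force
    next
      case False
      then obtain x where x: "mid i \<le> x" "x \<le> \<theta>" "f x = 0"
        using IVT2'[of f \<theta> 0 "mid i"] f cont unfolding f_def by (auto simp: less_imp_le)
      moreover from x f fm have "x \<noteq> \<theta>" "x \<noteq> mid i" by auto
      ultimately show ?thesis by force
    qed
    then obtain x where x: "\<theta> < x \<and> x < mid i \<or> mid i < x \<and> x < \<theta>" "f x = 0" by blast
    hence "a i < x" "x < a (Suc i)" using \<theta> mid[of i] by linarith+
    thus False using noncrit[OF A_V w, where i = i and \<theta> = x] f x by (auto simp: f_def)
  qed
  have hull: "cross e (w - v) \<ge> 0" if "w \<in> P" "\<And>x. x \<in> V \<Longrightarrow> cross e (x - v) \<ge> 0" for e v w
  proof -
    have "{x. cross e (x - v) \<ge> 0} = {x. (\<i> * e) \<bullet> x \<ge> (\<i> * e) \<bullet> v}"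
      by (auto simp: cross_def inner_complex_def algebra_simps)
    hence "convex {x. cross e (x - v) \<ge> 0}" by (simp add: convex_halfspace_ge)
    hence "P \<subseteq> {x. cross e (x - v) \<ge> 0}" unfolding P using that(2) by (intro hull_minimal) auto
    thus ?thesis using that(1) by blast
  qed
  show ?thesis
  proof (rule that[of n "\<lambda>i. cis (a i)" A])
    show "cross (cis (a i)) (cis (a (Suc i))) > 0" for i
      using a_Suc[of i] a_gap[of i] by (auto simp: cross_cis intro!: sin_gt_zero)
    show "A i \<in> P" for i unfolding P using A_V by (rule hull_inc)
    have "mid (i + n + n) = mid i + 2 * pi" for i
      using a_n[of i] a_n[of "i + n"] a_n[of "Suc i"] a_n[of "Suc i + n"] by (simp add: mid_def field_simps)
    hence "cis (mid (i + n + n)) = cis (mid i)" for i by (simp add: complex_eq_iff)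
    thus "A (i + n + n) = A i" for i by (simp add: A_def)
    show "cross (cis (a i)) (w - A i) \<ge> 0" if "w \<in> P" for i w
      by (rule hull[OF that weak]) (use a_Suc[of i] in auto)
    show "cross (cis (a (Suc i))) (w - A i) \<ge> 0" if "w \<in> P" for i w
      by (rule hull[OF that weak]) (use a_Suc[of i] in auto)
  qed (use n in \<open>auto simp: a_n cis_add_pi\<close>)
qed

section \<open>The closed chain of phases\<close>

lemma sum_lessThan_add: "sum f {..<m + n} = sum f {..<m} + (\<Sum>j<n. f (j + m))"
  for f :: "nat \<Rightarrow> 'a::comm_monoid_add"
  by (induction n) (simp_all add: ac_simps)

lemma periodic_mod:
  fixes f :: "nat \<Rightarrow> 'a"
  assumes "\<And>i. f (i + n) = f i"
  shows "f (i mod n) = f i"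
proof -
  have "f (j + q * n) = f j" for j q
  proof (induction q)
    case (Suc q)
    thus ?case using assms[of "j + q * n"] by (simp add: ac_simps)
  qed simp
  from this[of "i mod n" "i div n"] show ?thesis by simp
qed

lemma (in periodic_indices) closed_billiard_chain:
  assumes fin: "finite V" and P: "P = convex hull V" and int0: "0 \<in> interior P"
  obtains L :: nat and Y :: complex
  where "L > 0" "((0, Y), (K * L, Y)) \<in> (billiard_steps P lam)\<^sup>*"
proof -
  obtain r where r: "r > 0" "cball 0 r \<subseteq> P" using int0 by (auto simp: mem_interior_cball)
  have "V \<noteq> {}" using int0 P by auto
  then obtain n :: nat and u A where n: "n > 0" and u1: "\<And>i. norm (u i) = 1"
    and u_n: "\<And>i. u (i + n) = - u i" and uu: "\<And>i. cross (u i) (u (Suc i)) > 0"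
    and AP: "\<And>i. A i \<in> P" and A_n: "\<And>i. A (i + n + n) = A i"
    and A1: "\<And>i w. w \<in> P \<Longrightarrow> cross (u i) (w - A i) \<ge> 0"
    and A2: "\<And>i w. w \<in> P \<Longrightarrow> cross (u (Suc i)) (w - A i) \<ge> 0"
    using sectors[OF fin P] by metis
  \<comment> \<open>Tested at the point of the disc at distance \<open>r\<close> to the right of
    \<open>u i\<close>.\<close>
  have low: "cross (u i) a \<le> - r" if "\<And>w. w \<in> P \<Longrightarrow> cross (u i) (w - a) \<ge> 0" for i a
  proof -
    have "(- r) *\<^sub>R (\<i> * u i) \<in> cball 0 r" using u1[of i] r by (simp add: norm_mult)
    hence "cross (u i) ((- r) *\<^sub>R (\<i> * u i) - a) \<ge> 0" using r that by blast
    moreover have "cross (u i) (\<i> * u i) = 1"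
      using u1[of i] by (simp add: cross_def cmod_def power2_eq_square)
    ultimately show ?thesis by (simp add: cross_diff)
  qed
  have low1: "cross (u i) (A i) \<le> - r" and low2: "cross (u (Suc i)) (A i) \<le> - r" for i
    by (rule low, erule A1, rule low, erule A2)
  have high1: "cross (u i) (A (i + n)) \<ge> r" and high2: "cross (u (Suc i)) (A (i + n)) \<ge> r" for i
    using low1[of "i + n"] low2[of "i + n"] u_n[of i] u_n[of "Suc i"] by auto
  define \<delta> where "\<delta> i = A (i + n) - A i" for i
  define width where "width i = cross (u i) (\<delta> i)" for i
  have width_pos: "width i > 0" for i
    using low1[of i] high1[of i] r by (simp add: width_def \<delta>_def cross_diff)
  have \<delta>_n: "\<delta> (i + n) = - \<delta> i" for i by (simp add: \<delta>_def A_n)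
  have width_n: "width (i + n) = width i" for i by (simp add: width_def \<delta>_n u_n)
  \<comment> \<open>Both vertices minimise \<open>cross (u (Suc i))\<close> over \<open>P\<close>,
    so neighbouring \<open>\<delta>\<close> see the same width along their common ray.\<close>
  have min_eq: "cross (u (Suc i)) (A (Suc i)) = cross (u (Suc i)) (A i)" for i
    using A1[OF AP[of i], of "Suc i"] A2[OF AP[of "Suc i"], of i] by (simp add: cross_diff)
  have width_Suc: "cross (u (Suc i)) (\<delta> i) = width (Suc i)" for i
    using min_eq[of i] min_eq[of "i + n"] u_n[of "Suc i"] by (simp add: width_def \<delta>_def cross_diff)
  \<comment> \<open>Normalised so that \<open>p i\<close> and \<open>p (Suc i)\<close> both have
    cross product 1 with \<open>\<delta> i\<close>; hence their difference is parallel to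
    \<open>\<delta> i\<close>.\<close>
  define p where "p i = (1 / width i) *\<^sub>R u i" for i
  define \<mu> where "\<mu> i = cross (u i) (u (Suc i)) / (width i * width (Suc i))" for i
  have \<mu>_pos: "\<mu> i > 0" for i using uu width_pos by (simp add: \<mu>_def)
  have \<mu>_n: "\<mu> (i + n) = \<mu> i" for i
    using width_n[of i] width_n[of "Suc i"] u_n[of i] u_n[of "Suc i"] by (simp add: \<mu>_def)
  have p_Suc: "p (Suc i) = p i + \<mu> i *\<^sub>R \<delta> i" for i
  proof -
    have "cross (u i) (u (Suc i)) *\<^sub>R \<delta> i = width i *\<^sub>R u (Suc i) - width (Suc i) *\<^sub>R u i"
      unfolding width_Suc[symmetric] width_def[of i]
      by (simp add: cross_def complex_eq_iff algebra_simps)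
    hence "(1 / (width i * width (Suc i))) *\<^sub>R (cross (u i) (u (Suc i)) *\<^sub>R \<delta> i)
      = (1 / (width i * width (Suc i))) *\<^sub>R (width i *\<^sub>R u (Suc i) - width (Suc i) *\<^sub>R u i)" by simp
    thus ?thesis using width_pos[of i] width_pos[of "Suc i"]
      by (simp add: \<mu>_def p_def scaleR_diff_right)
  qed
  define W where "W = cumsum lam K"
  have W: "W > 0" by (simp add: W_def cumsum_K_pos)
  define D where "D = (\<Sum>j<n + n. norm (\<delta> j))"
  have D: "D \<ge> 0" by (simp add: D_def sum_nonneg)
  \<comment> \<open>Accuracy \<open>1 / M\<close> per side keeps the accumulated corner error, at
    most \<open>W / M * D\<close>, below \<open>r\<close>.\<close>
  obtain M :: nat where M: "W * D / r < real M" using reals_Archimedean2 by blast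
  have "0 \<le> W * D / r" using W D r by simp
  hence M0: "real M > 0" using M by linarith
  have MD: "W / M * D < r" using M M0 r by (simp add: field_simps)
  obtain q :: int and N :: "nat \<Rightarrow> int" where q: "q > 0"
    and N: "\<And>i. i < n \<Longrightarrow> \<bar>of_int q * (\<mu> i / \<mu> 0) - of_int (N i)\<bar> < 1 / M"
    using Dirichlet_approx_simult[of M n "\<lambda>i. \<mu> i / \<mu> 0"] M0 by (metis of_nat_0_less_iff)
  define t where "t = of_int q * W / \<mu> 0"
  \<comment> \<open>Periodicity modulo \<open>n\<close> gives opposite sides equal counts, so that
    they cancel exactly.\<close>
  define c where "c i = nat (N (i mod n))" for i
  have c_n: "c (i + n) = c i" for i by (simp add: c_def)
  have M1: "1 / real M \<le> 1" using M0 by simp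
  have N_nonneg: "N i \<ge> 0" if "i < n" for i
  proof -
    have "of_int q * (\<mu> i / \<mu> 0) > 0" using q \<mu>_pos by simp
    hence "real_of_int (N i) > - 1" using N[OF that] M1 by linarith
    thus ?thesis by linarith
  qed
  have approx: "\<bar>real (c i) * W - t * \<mu> i\<bar> \<le> W / M" for i
  proof -
    have lt: "i mod n < n" using n by simp
    have "\<bar>real (c i) - of_int q * (\<mu> i / \<mu> 0)\<bar> < 1 / M"
      using N[OF lt] N_nonneg[OF lt] periodic_mod[of \<mu>, OF \<mu>_n, of i] by (simp add: c_def abs_minus_commute)
    hence "W * \<bar>real (c i) - of_int q * (\<mu> i / \<mu> 0)\<bar> \<le> W * (1 / M)"
      using W by (intro mult_left_mono) auto
    also have "W * \<bar>real (c i) - of_int q * (\<mu> i / \<mu> 0)\<bar> = \<bar>W * (real (c i) - of_int q * (\<mu> i / \<mu> 0))\<bar>"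
      using W by (simp add: abs_mult)
    finally show ?thesis by (simp add: t_def algebra_simps)
  qed
  \<comment> \<open>The ratio at 0 is 1, so \<open>N 0 = q\<close>. Other counts may round to 0,
    which only makes their phases empty.\<close>
  have c0: "c 0 > 0"
  proof -
    have "\<bar>real_of_int q - of_int (N 0)\<bar> < 1" using N[of 0] n \<mu>_pos[of 0] M1 by simp
    thus ?thesis using q n by (simp add: c_def)
  qed
  txt \<open>The corners of the periodic orbit. Those of the ideal closed curve are \<open>t *\<^sub>R p i\<close>; Dirichlet's theorem
    makes all its side lengths \<open>t * \<mu> i\<close> simultaneously close to integer multiples of \<open>W\<close>.\<close>
  define Y where "Y i = t *\<^sub>R p 0 + (\<Sum>j<i. (real (c j) * W) *\<^sub>R \<delta> j)" for i
  have Y_eq: "Y i = t *\<^sub>R p i + (\<Sum>j<i. (real (c j) * W - t * \<mu> j) *\<^sub>R \<delta> j)" for i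
    by (induction i) (simp_all add: Y_def p_Suc algebra_simps)
  have err: "\<bar>cross (u i) (Y i)\<bar> < r" if "i \<le> n + n" for i
  proof -
    \<comment> \<open>The ideal corner is parallel to \<open>u i\<close> and drops out; only the
      rounding error remains.\<close>
    have "cross (u i) (Y i) = cross (u i) (\<Sum>j<i. (real (c j) * W - t * \<mu> j) *\<^sub>R \<delta> j)"
      by (simp add: Y_eq cross_add p_def)
    also have "\<bar>\<dots>\<bar> \<le> norm (u i) * norm (\<Sum>j<i. (real (c j) * W - t * \<mu> j) *\<^sub>R \<delta> j)"
      by (rule abs_cross_le)
    also have "\<dots> = norm (\<Sum>j<i. (real (c j) * W - t * \<mu> j) *\<^sub>R \<delta> j)"
      by (simp only: u1 mult_1)
    also have "\<dots> \<le> (\<Sum>j<i. W / M * norm (\<delta> j))"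
      by (rule sum_norm_le) (simp add: mult_right_mono[OF approx] del: times_divide_eq_left)
    also have "\<dots> \<le> W / M * D"
      unfolding D_def sum_distrib_left using that W by (intro sum_mono2) auto
    finally show ?thesis using MD by linarith
  qed
  have chain: "i \<le> n + n \<Longrightarrow> ((0, Y 0), (K * (\<Sum>j<i. c j), Y i)) \<in> (billiard_steps P lam)\<^sup>*" for i
  proof (induction i)
    case (Suc i)
    have "((K * (\<Sum>j<i. c j), Y i), (K * (\<Sum>j<i. c j) + K * c i, Y (Suc i))) \<in> (billiard_steps P lam)\<^sup>*"
    proof (rule billiard_phase[where u = "u i" and u' = "u (Suc i)" and A = "A i" and A' = "A (i + n)"])
      show "Y (Suc i) = Y i + (real (c i) * cumsum lam K) *\<^sub>R (A (i + n) - A i)"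
        by (simp add: Y_def W_def \<delta>_def)
      show "cross (u i) (Y i - A i) > 0"
        using err[of i] Suc.prems low1[of i] by (simp add: cross_diff)
      show "cross (u (Suc i)) (Y (Suc i) - A (i + n)) < 0"
        using err[of "Suc i"] Suc.prems high2[of i] by (simp add: cross_diff)
      show "cross (u i) (w - A (i + n)) \<le> 0" if "w \<in> P" for w
        using A1[OF that, of "i + n"] by (simp add: u_n)
      show "cross (u (Suc i)) (w - A (i + n)) \<le> 0" if "w \<in> P" for w
        using A2[OF that, of "i + n"] u_n[of "Suc i"] by simp
    qed (use uu AP A1 A2 in auto)
    thus ?case using Suc by (simp add: algebra_simps)
  qed simp
  have "Y (n + n) = Y 0"
    by (simp add: Y_def sum_lessThan_add \<delta>_n c_n sum_negf)
  moreover have "(\<Sum>j<n + n. c j) > 0"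
    using c0 n by (intro sum_pos2[of _ 0]) auto
  ultimately show ?thesis using chain[of "n + n"] that by auto
qed

section \<open>From the closed chain to a periodic orbit\<close>

text \<open>Each step raises the time component by one, so the length of the chain is its final
  time.\<close>

lemma billiard_chain_sequence:
  assumes "((0, Y), (M, Y')) \<in> (billiard_steps P lam)\<^sup>*"
  obtains g v where "g 0 = Y" "g M = Y'"
    "\<And>i. i < M \<Longrightarrow> strict_contact 1 P (g i) (v i)"
    "\<And>i. i < M \<Longrightarrow> g (Suc i) = refract (v i) (lam (Suc i)) (g i)"
proof -
  obtain M' where "((0, Y), (M, Y')) \<in> billiard_steps P lam ^^ M'"
    using rtrancl_imp_relpow[OF assms] by blast
  then obtain f where f: "f 0 = (0, Y)" "f M' = (M, Y')" "\<And>i. i < M' \<Longrightarrow> (f i, f (Suc i)) \<in> billiard_steps P lam"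
    by (auto simp: relpow_fun_conv)
  have fst: "i \<le> M' \<Longrightarrow> fst (f i) = i" for i
  proof (induction i)
    case (Suc i)
    thus ?case using f(3)[of i] by (auto simp: billiard_steps_def)
  qed (simp add: f)
  have M': "M' = M" using fst[of M'] f by simp
  have "\<forall>i. \<exists>v. i < M \<longrightarrow> strict_contact 1 P (snd (f i)) v \<and> snd (f (Suc i)) = refract v (lam (Suc i)) (snd (f i))"
  proof
    fix i
    show "\<exists>v. i < M \<longrightarrow> strict_contact 1 P (snd (f i)) v \<and> snd (f (Suc i)) = refract v (lam (Suc i)) (snd (f i))"
      using f(3)[of i] fst[of i] M' by (fastforce simp: billiard_steps_def)
  qed
  then obtain v where "\<forall>i. i < M \<longrightarrow> strict_contact 1 P (snd (f i)) (v i) \<and> snd (f (Suc i)) = refract (v i) (lam (Suc i)) (snd (f i))"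
    by metis
  thus ?thesis using that[of "\<lambda>i. snd (f i)" v] f M' by auto
qed

lemma cyclic_index_add [simp]: "cyclic_index k l (m + int k * j) = cyclic_index k l m"
proof -
  have "m + int k * j - 1 = (m - 1) + int k * j" by simp
  thus ?thesis by (simp only: cyclic_index_def mod_mult_self2)
qed

lemma cyclic_index_pos:
  assumes "k \<ge> 1" "\<And>i. i \<in> {1..k} \<Longrightarrow> l i > 0"
  shows "cyclic_index k l m > 0"
proof -
  have "0 \<le> (m - 1) mod int k" "(m - 1) mod int k < int k" using assms(1) by auto
  hence "nat ((m - 1) mod int k) + 1 \<in> {1..k}" by (auto simp: nat_less_iff Suc_le_eq)
  thus ?thesis unfolding cyclic_index_def by (rule assms(2))
qed

lemma cyclic_index_nat: "j \<in> {1..k} \<Longrightarrow> cyclic_index k l (int j) = l j"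
  by (auto simp: cyclic_index_def nat_diff_distrib)

lemma cumprod_cyclic_index:
  assumes "k \<ge> 1" "(\<Prod>i=1..k. l i) = 1"
  shows "cumprod (\<lambda>j. cyclic_index k l (int j)) (2 * k) = 1"
proof -
  define lam where "lam j = cyclic_index k l (int j)" for j
  have k: "cumprod lam k = 1"
    unfolding cumprod_def lam_def assms(2)[symmetric] by (intro prod.cong cyclic_index_nat refl)
  have "cumprod lam (r + k) = cumprod lam r" for r
  proof (induction r)
    case (Suc r)
    have "lam (Suc (r + k)) = lam (Suc r)"
    proof -
      have "int (Suc (r + k)) = int (Suc r) + int k * 1" by simp
      thus ?thesis by (simp only: lam_def cyclic_index_add)
    qed
    thus ?case using Suc by simp
  qed (simp add: k)
  from this[of k] show ?thesis using k by (simp add: mult_2 lam_def[abs_def])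
qed

theorem theorem3:
  fixes P :: "complex set" and k :: nat and l :: "nat \<Rightarrow> real"
  assumes "convex_polygon P"
    and "k \<ge> 1"
    and "\<And>i. i \<in> {1..k} \<Longrightarrow> l i > 0"
    and "(\<Prod>i=1..k. l i) = 1"
  shows "\<exists>p. strongly_regular P k l p \<and> periodic_orbit P k l p"
proof -
  have pos: "cyclic_index k l m > 0" for m by (rule cyclic_index_pos[OF assms(2,3)])
  define lam where "lam j = cyclic_index k l (int j)" for j
  \<comment> \<open>Doubling \<open>k\<close> makes the period even whatever the parity of
    \<open>k\<close>.\<close>
  interpret periodic_indices lam "2 * k"
  proof
    show "lam j > 0" for j by (simp add: lam_def pos)
    show "lam (Suc j + 2 * k) = lam (Suc j)" for j
    proof -
      have "int (Suc j + 2 * k) = int (Suc j) + int k * 2" by simp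
      thus ?thesis by (simp only: lam_def cyclic_index_add)
    qed
    show "cumprod lam (2 * k) = 1"
      using cumprod_cyclic_index[OF assms(2,4)] by (simp add: lam_def[abs_def])
  qed (use assms(2) in auto)
  obtain c where c: "c \<in> interior P" using assms(1) by (auto simp: convex_polygon_def)
  obtain V where V: "finite V" "P = convex hull V"
    using assms(1) by (auto simp: convex_polygon_def polytope_def)
  \<comment> \<open>Translated to put the origin inside, as \<open>closed_billiard_chain\<close>
    requires.\<close>
  define P0 where "P0 = (+) (- c) ` P"
  have P0: "P0 = convex hull ((+) (- c) ` V)"
    by (simp only: P0_def V(2) convex_hull_translation)
  have "0 \<in> interior P0" unfolding P0_def interior_translation using c by force
  then obtain L Y where L: "L > 0" and chain: "((0, Y), (2 * k * L, Y)) \<in> (billiard_steps P0 lam)\<^sup>*"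
    using closed_billiard_chain[OF _ P0] V(1) by auto
  define M where "M = 2 * k * L"
  obtain g v where g: "g 0 = Y" "g M = Y" "\<And>i. i < M \<Longrightarrow> strict_contact 1 P0 (g i) (v i)"
    "\<And>i. i < M \<Longrightarrow> g (Suc i) = refract (v i) (lam (Suc i)) (g i)"
    using billiard_chain_sequence[OF chain] unfolding M_def by blast
  have M: "M > 0" using L assms(2) by (simp add: M_def)
  \<comment> \<open>The closed chain is repeated over all integers and translated back.\<close>
  define z where "z m = c + g (nat (m mod int M))" for m
  define A where "A m = c + v (nat (m mod int M))" for m
  have contact: "strict_contact 1 P (z m) (A m)" for m
  proof -
    have "nat (m mod int M) < M" using M by (simp add: nat_less_iff)
    from g(3)[OF this] show ?thesis
      by (auto simp: strict_contact_def P0_def z_def A_def algebra_simps)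
  qed
  have step: "z (m + 1) = refract (A m) (cyclic_index k l (m + 1)) (z m)" for m
  proof -
    define i where "i = nat (m mod int M)"
    have i: "i < M" "m mod int M = int i" using M by (auto simp: i_def nat_less_iff)
    have "g (nat ((m + 1) mod int M)) = g (Suc i)"
    proof (cases "Suc i = M")
      case True
      have "(m + 1) mod int M = (int i + 1) mod int M" using i(2) by (metis mod_add_left_eq)
      also have "\<dots> = 0" using True by (metis mod_self of_nat_Suc add.commute)
      finally show ?thesis using g(1,2) True by simp
    next
      case False
      have "(m + 1) mod int M = (int i + 1) mod int M" using i(2) by (metis mod_add_left_eq)
      also have "\<dots> = int (Suc i)" using False i(1) by simp
      finally show ?thesis by (simp only: nat_int)
    qed
    moreover have "lam (Suc i) = cyclic_index k l (m + 1)"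
    proof -
      \<comment> \<open>\<open>M\<close> is a multiple of \<open>k\<close>, so reducing the time
        modulo \<open>M\<close> preserves the index.\<close>
      have "m + 1 = int (Suc i) + int k * (2 * int L * (m div int M))"
        using i(2) mult_div_mod_eq[of "int M" m] by (simp add: M_def algebra_simps)
      thus ?thesis by (simp only: lam_def cyclic_index_add)
    qed
    ultimately show ?thesis
      using g(4)[OF i(1)] by (simp add: z_def A_def i_def refract_def algebra_simps)
  qed
  have orbit: "orbit P k l (z 0) m = z m" and "regular_point P (z m)" for m
    by (rule orbit_eq[OF assms(1) pos contact step])+
  hence "strongly_regular P k l (z 0)" by (simp add: strongly_regular_def)
  moreover have "periodic_orbit P k l (z 0)"
    unfolding periodic_orbit_def
  proof (intro exI[of _ "int M"] conjI allI)
    show "orbit P k l (z 0) (m + int M) = orbit P k l (z 0) m" for m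
      unfolding orbit by (simp add: z_def)
    show "cyclic_index k l (m + int M) = cyclic_index k l m" for m
    proof -
      have "m + int M = m + int k * (2 * int L)" by (simp add: M_def)
      thus ?thesis by (simp only: cyclic_index_add)
    qed
  qed (use M in simp)
  ultimately show ?thesis by blast
qed

end
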